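(* For $\alpha>0$ let $D_\alpha=[0,\alpha]\times[0,\alpha^{-1}]\times[0,1]\subset\mathbb{R}^3$ and $$\Delta(\alpha):=\int_{D_\alpha}\int_{D_\alpha}\frac{d^3x\,d^3y}{|x-y|}.$$ Then $\Delta(\alpha)=\Delta(\alpha^{-1})$ for all $\alpha>0$. Moreover, the function $\beta\mapsto\Delta(e^\beta)$ is strictly decreasing for $\beta>0$. Consequently, $$\Delta(\alpha)\le\Delta(1),$$ with equality if and only if $\alpha=1$.
   Context: $|x-y|$ denotes the Euclidean distance in $\mathbb{R}^3$. *)

theory Defs
  imports "HOL-Analysis.Analysis"
begin

definition box_D :: "real \<Rightarrow> (real ^ 3) set" where
  "box_D \<alpha> = {x. x $ 1 \<in> {0..\<alpha>} \<and> x $ 2 \<in> {0..inverse \<alpha>} \<and> x $ 3 \<in> {0..1}}"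

text \<open>
  The iterated Lebesgue integral of the Coulomb kernel. On the null set \<open>x = y\<close> the integrand
  takes the value \<open>1 / 0 = 0\<close>; this does not affect the integral.
\<close>

definition Delta :: "real \<Rightarrow> real" where
  "Delta \<alpha> = (LINT y:box_D \<alpha>|lborel. (LINT x:box_D \<alpha>|lborel. 1 / dist x y))"

end

theory Submission
  imports Defs
begin

text \<open>
  Integrating over the difference \<open>z = x - y\<close> turns the double integral into
  \<open>Delta \<alpha> = \<integral> overlap \<alpha> z / \<bar>z\<bar> dz\<close>, where \<open>overlap \<alpha> z\<close> is the volume of the
  intersection of \<open>D\<^sub>\<alpha>\<close> with its translate by \<open>- z\<close>, a product of three tent functions
  (\<open>Delta_eq_overlap_integral\<close>).

  In the coordinates \<open>m = sqrt (z\<^sub>1 z\<^sub>2)\<close> and \<open>\<theta> = ln (z\<^sub>1 / z\<^sub>2) / 2\<close> on \<open>z\<^sub>1, z\<^sub>2 > 0\<close>, the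
  measure is \<open>2 m dm d\<theta> dz\<^sub>3\<close>. For fixed \<open>m\<close> and \<open>z\<^sub>3\<close> the overlap is an even function of
  \<open>\<theta> - ln \<alpha>\<close> that does not increase with the absolute value of its argument, and \<open>1 / \<bar>z\<bar>\<close> is such a
  function of \<open>\<theta>\<close>. So \<open>Delta \<alpha>\<close> is a superposition of convolutions of two symmetric decreasing
  profiles, and such convolutions do not increase as the distance \<open>\<bar>ln \<alpha>\<bar>\<close> between the centres grows.

  To compare two centres \<open>ln a < ln b\<close> with positive sum, reflect \<open>\<theta>\<close> about their midpoint. In
  Cartesian coordinates this reflection is the linear map
  \<open>T (z\<^sub>1, z\<^sub>2, z\<^sub>3) = (M z\<^sub>2, z\<^sub>1 / M, z\<^sub>3)\<close> with \<open>M = a * b > 1\<close>.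
  It preserves the measure (\<open>lborel_distr_reflect\<close>) and exchanges
  the two overlaps (\<open>overlap_reflect\<close>). Averaging the integral with its image under \<open>T\<close> gives
  \<open>2 (Delta a - Delta b) = \<integral> (overlap a z - overlap b z) (1 / \<bar>z\<bar> - 1 / \<bar>T z\<bar>) dz\<close>.
  On the side \<open>\<bar>z\<^sub>1\<bar> \<le> M \<bar>z\<^sub>2\<bar>\<close> of the mirror both factors are nonnegative (\<open>overlap_le\<close>,
  \<open>norm_reflect_le\<close>), on the other side both are nonpositive, and they are nonzero on a small
  box. Hence \<open>Delta b < Delta a\<close> (\<open>Delta_strict_antimono\<close>). The symmetry
  \<open>Delta \<alpha> = Delta (1 / \<alpha>)\<close> is the case \<open>M = 1\<close> of the same change of variables.
\<close>

section \<open>Integrability of the Coulomb kernel\<close>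

text \<open>
  In dimension \<open>d \<ge> 2\<close> the kernel \<open>1 / \<bar>x - y\<bar>\<close> is at most \<open>1\<close> plus a dyadic sum of multiples
  \<open>2 ^ (n + 1)\<close> of indicators of balls of radius \<open>2 ^ (- n)\<close> about \<open>y\<close>. The total mass \<open>C\<close> of that
  sum is finite, because the \<open>n\<close>-th term has mass of order \<open>2 ^ (n - n d)\<close>, and it is the
  same for every \<open>y\<close>.
\<close>

lemma nn_integral_inverse_dist_bounded:
  assumes dim: "2 \<le> DIM('a::euclidean_space)"
  obtains C :: ennreal where "C < \<infinity>"
    and "\<And>S y :: 'a. S \<in> sets borel \<Longrightarrow>
      (\<integral>\<^sup>+x. indicator S x * ennreal (1 / dist x y) \<partial>lborel) \<le> emeasure lborel S + C"
proof -
  let ?V = "unit_ball_vol (real DIM('a))"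
  define a :: "nat \<Rightarrow> real" where "a n = 2 ^ Suc n * (?V * (1 / 2 ^ n) ^ DIM('a))" for n
  have V: "0 \<le> ?V" by simp
  have a0: "0 \<le> a n" for n using V by (simp add: a_def)
  have "summable a"
  proof (rule summable_comparison_test')
    show "summable (\<lambda>n. 2 * ?V * (1 / 2) ^ n)"
      by (intro summable_mult summable_geometric) simp
    fix n :: nat
    have "(1 / 2 ^ n :: real) ^ DIM('a) \<le> (1 / 2 ^ n) ^ 2"
      by (rule power_decreasing) (use dim in auto)
    then have "a n \<le> 2 ^ Suc n * (?V * (1 / 2 ^ n) ^ 2)"
      unfolding a_def by (intro mult_left_mono) (use V in auto)
    also have "\<dots> = 2 * ?V * (1 / 2) ^ n"
      by (simp add: power2_eq_square power_divide)
    finally show "norm (a n) \<le> 2 * ?V * (1 / 2) ^ n" using a0 by simp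
  qed
  then have fin: "(\<Sum>n. ennreal (a n)) < \<infinity>"
    using a0 by (simp add: suminf_ennreal2 less_top)
  let ?h = "\<lambda>n (x::'a) y. ennreal (2 ^ Suc n) * indicator (cball y (1 / 2 ^ n)) x"
  \<comment> \<open>The summand that dominates is the one for the dyadic shell containing \<open>x\<close>.\<close>
  have pointwise: "ennreal (1 / dist x y) \<le> 1 + (\<Sum>n. ?h n x y)" for x y :: 'a
  proof (cases "dist x y < 1 \<and> x \<noteq> y")
    case False
    then have "1 / dist x y \<le> 1" by (auto simp: divide_simps)
    then have "ennreal (1 / dist x y) \<le> 1" by (simp add: ennreal_leI flip: ennreal_1)
    then show ?thesis by (rule add_increasing2[OF zero_le])
  next
    case True
    define N where "N = (LEAST n. (1 / 2 :: real) ^ Suc n \<le> dist x y)"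
    obtain m where m: "(1 / 2 :: real) ^ m < dist x y"
      using real_arch_pow_inv[of "dist x y" "1 / 2"] True by auto
    have "(1 / 2 :: real) ^ Suc m \<le> (1 / 2) ^ m" by simp
    with m have "(1 / 2 :: real) ^ Suc m \<le> dist x y" by linarith
    then have N: "(1 / 2 :: real) ^ Suc N \<le> dist x y"
      unfolding N_def by (rule LeastI)
    have mem: "x \<in> cball y (1 / 2 ^ N)"
    proof (cases N)
      case 0
      then show ?thesis using True by (simp add: dist_commute)
    next
      case (Suc k)
      then have "k < N" by simp
      then have "\<not> (1 / 2 :: real) ^ Suc k \<le> dist x y"
        unfolding N_def by (rule not_less_Least)
      then show ?thesis using Suc by (simp add: dist_commute power_divide)
    qed
    have "1 / dist x y \<le> 2 ^ Suc N"
      using N True by (simp add: field_simps)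
    then have "ennreal (1 / dist x y) \<le> ?h N x y"
      using mem by (simp add: ennreal_leI)
    also have "\<dots> = (\<Sum>n\<in>{N}. ?h n x y)" by (simp del: sum_mult_indicator)
    also have "\<dots> \<le> (\<Sum>n. ?h n x y)"
      by (rule sum_le_suminf) auto
    finally show ?thesis by (simp add: add_increasing)
  qed
  have [measurable]: "(\<lambda>x. ?h n x y) \<in> borel_measurable lborel" for n and y :: 'a
    by (intro borel_measurable_times_ennreal borel_measurable_const borel_measurable_indicator) auto
  have int_h: "(\<integral>\<^sup>+x. (\<Sum>n. ?h n x y) \<partial>lborel) = (\<Sum>n. ennreal (a n))" for y :: 'a
  proof -
    have "(\<integral>\<^sup>+x. ?h n x y \<partial>lborel) = ennreal (a n)" for n
      using V by (subst nn_integral_cmult_indicator)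
        (simp_all add: emeasure_cball a_def ennreal_mult[symmetric] del: power_Suc)
    then have "(\<Sum>n. \<integral>\<^sup>+x. ?h n x y \<partial>lborel) = (\<Sum>n. ennreal (a n))"
      by (simp only:)
    moreover have "(\<integral>\<^sup>+x. (\<Sum>n. ?h n x y) \<partial>lborel) = (\<Sum>n. \<integral>\<^sup>+x. ?h n x y \<partial>lborel)"
      by (rule nn_integral_suminf) measurable
    ultimately show ?thesis by (simp only:)
  qed
  show thesis
  proof (rule that[OF fin])
    fix S :: "'a set" and y
    assume [measurable]: "S \<in> sets borel"
    have "(\<integral>\<^sup>+x. indicator S x * ennreal (1 / dist x y) \<partial>lborel)
        \<le> (\<integral>\<^sup>+x. indicator S x + (\<Sum>n. ?h n x y) \<partial>lborel)"
      by (rule nn_integral_mono) (use pointwise in \<open>auto split: split_indicator\<close>)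
    also have "\<dots> = emeasure lborel S + (\<Sum>n. ennreal (a n))"
    proof (subst nn_integral_add)
      show "(\<lambda>x. \<Sum>n. ?h n x y) \<in> borel_measurable lborel" by measurable
    qed (simp_all only: int_h nn_integral_indicator borel_measurable_indicator sets_lborel \<open>S \<in> sets borel\<close>)
    finally show "(\<integral>\<^sup>+x. indicator S x * ennreal (1 / dist x y) \<partial>lborel)
        \<le> emeasure lborel S + (\<Sum>n. ennreal (a n))" .
  qed
qed

section \<open>Reduction to an integral over the difference variable\<close>

lemma emeasure_lborel_cbox_vec3:
  fixes l u :: "real ^ 3"
  shows "emeasure lborel (cbox l u) =
    ennreal (max 0 (u$1 - l$1) * max 0 (u$2 - l$2) * max 0 (u$3 - l$3))"
proof -
  have "measure lborel (cbox l u) = max 0 (u$1 - l$1) * max 0 (u$2 - l$2) * max 0 (u$3 - l$3)"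
  proof (cases "cbox l u = {}")
    case True
    then obtain i where "u $ i < l $ i" using interval_eq_empty_cart(2) by blast
    then show ?thesis using True exhaust_3[of i] by auto
  next
    case False
    then have "l $ i \<le> u $ i" for i by (simp add: interval_ne_empty_cart)
    then have "max 0 (u$i - l$i) = u$i - l$i" for i by simp
    moreover have "(\<Prod>i\<in>UNIV. u$i - l$i) = (u$1 - l$1) * (u$2 - l$2) * (u$3 - l$3)"
      unfolding UNIV_3 by simp
    ultimately show ?thesis unfolding content_cbox_cart[OF False] by (simp only:)
  qed
  moreover have "emeasure lborel (cbox l u) \<noteq> top"
    using emeasure_lborel_cbox_finite[of l u] by auto
  ultimately show ?thesis by (simp add: emeasure_eq_ennreal_measure)
qed

text \<open>
  The volume of the set of all \<open>y \<in> D\<^sub>\<alpha>\<close> with \<open>z + y \<in> D\<^sub>\<alpha>\<close>, see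
  \<open>nn_integral_box_D_translate\<close> below.
\<close>

definition overlap :: "real \<Rightarrow> real ^ 3 \<Rightarrow> real" where
  "overlap \<alpha> z = max 0 (\<alpha> - \<bar>z$1\<bar>) * max 0 (inverse \<alpha> - \<bar>z$2\<bar>) * max 0 (1 - \<bar>z$3\<bar>)"

lemma box_D_eq_cbox: "box_D \<alpha> = cbox (vector [0, 0, 0]) (vector [\<alpha>, inverse \<alpha>, 1])"
  by (auto simp: box_D_def mem_box_cart forall_3)

lemma measurable_box_D [measurable]: "box_D \<alpha> \<in> sets borel"
  by (simp add: box_D_eq_cbox)

lemma emeasure_box_D_finite: "emeasure lborel (box_D \<alpha>) < \<infinity>"
  by (simp add: box_D_eq_cbox emeasure_lborel_cbox_vec3)

lemma overlap_nonneg: "0 \<le> overlap \<alpha> z"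
  by (simp add: overlap_def)

lemma measurable_overlap [measurable]: "overlap \<alpha> \<in> borel_measurable borel"
  unfolding overlap_def by (intro borel_measurable_continuous_onI continuous_intros)

lemma nn_integral_box_D_translate:
  "(\<integral>\<^sup>+y. indicator (box_D \<alpha>) y * indicator (box_D \<alpha>) (z + y) \<partial>lborel) = ennreal (overlap \<alpha> z)"
proof -
  let ?L = "vector [max 0 (- z$1), max 0 (- z$2), max 0 (- z$3)] :: real ^ 3"
  let ?U = "vector [min \<alpha> (\<alpha> - z$1), min (inverse \<alpha>) (inverse \<alpha> - z$2), min 1 (1 - z$3)] :: real ^ 3"
  have "y \<in> box_D \<alpha> \<and> z + y \<in> box_D \<alpha> \<longleftrightarrow> y \<in> cbox ?L ?U" for y
    by (simp add: box_D_def mem_box_cart forall_3) (safe; linarith)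
  then have "(indicator (box_D \<alpha>) y * indicator (box_D \<alpha>) (z + y) :: ennreal) = indicator (cbox ?L ?U) y" for y
    by (auto simp: indicator_def)
  then have "(\<integral>\<^sup>+y. indicator (box_D \<alpha>) y * indicator (box_D \<alpha>) (z + y) \<partial>lborel)
      = emeasure lborel (cbox ?L ?U)"
    by simp
  moreover have "min a (a - t) - max 0 (- t) = a - \<bar>t\<bar>" for a t :: real
    by (auto simp: min_def max_def)
  ultimately show ?thesis
    by (simp add: emeasure_lborel_cbox_vec3 overlap_def)
qed

text \<open>
  Substituting \<open>x = z + y\<close> and exchanging the order of integration leaves, for each \<open>z\<close>, the
  overlap volume as the integral over \<open>y\<close>.
\<close>

lemma nn_integral_box_D_kernel:
  "(\<integral>\<^sup>+y. indicator (box_D \<alpha>) y * (\<integral>\<^sup>+x. indicator (box_D \<alpha>) x * ennreal (1 / dist x y) \<partial>lborel) \<partial>lborel)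
    = (\<integral>\<^sup>+z. ennreal (overlap \<alpha> z / norm z) \<partial>lborel)"
proof -
  let ?D = "box_D \<alpha>"
  have inner: "(\<integral>\<^sup>+x. indicator ?D x * ennreal (1 / dist x y) \<partial>lborel)
      = (\<integral>\<^sup>+z. indicator ?D (z + y) * ennreal (1 / norm z) \<partial>lborel)" for y
  proof -
    have "(\<integral>\<^sup>+x. indicator ?D x * ennreal (1 / dist x y) \<partial>lborel)
       = (\<integral>\<^sup>+x. indicator ?D x * ennreal (1 / dist x y) \<partial>distr lborel borel ((+) y))"
      by (simp add: lborel_distr_plus)
    also have "\<dots> = (\<integral>\<^sup>+z. indicator ?D (y + z) * ennreal (1 / dist (y + z) y) \<partial>lborel)"
      by (rule nn_integral_distr) measurable
    finally show ?thesis by (simp add: dist_norm add.commute)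
  qed
  have "(\<integral>\<^sup>+y. indicator ?D y * (\<integral>\<^sup>+x. indicator ?D x * ennreal (1 / dist x y) \<partial>lborel) \<partial>lborel)
      = (\<integral>\<^sup>+y. \<integral>\<^sup>+z. indicator ?D y * (indicator ?D (z + y) * ennreal (1 / norm z)) \<partial>lborel \<partial>lborel)"
    by (simp add: inner nn_integral_cmult)
  also have "\<dots> = (\<integral>\<^sup>+z. \<integral>\<^sup>+y. indicator ?D y * (indicator ?D (z + y) * ennreal (1 / norm z)) \<partial>lborel \<partial>lborel)"
    by (rule lborel_pair.Fubini') measurable
  also have "\<dots> = (\<integral>\<^sup>+z. ennreal (overlap \<alpha> z) * ennreal (1 / norm z) \<partial>lborel)"
    by (simp add: mult.assoc[symmetric] nn_integral_multc nn_integral_box_D_translate)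
  also have "\<dots> = (\<integral>\<^sup>+z. ennreal (overlap \<alpha> z / norm z) \<partial>lborel)"
    by (simp add: ennreal_mult'[symmetric] overlap_nonneg)
  finally show ?thesis .
qed

text \<open>
  Bochner integrals of nonnegative functions are the real values of their nonnegative integrals,
  so the formula for \<open>Delta\<close> follows from the previous one once the inner integrals are known to
  be finite. The uniform bound on the inner integrals over the bounded box gives this, and
  finiteness of the outer integral as well.
\<close>

lemma
  shows integrable_overlap_kernel: "integrable lborel (\<lambda>z. overlap \<alpha> z / norm z)"
    and Delta_eq_overlap_integral: "Delta \<alpha> = (LINT z|lborel. overlap \<alpha> z / norm z)"
proof -
  let ?D = "box_D \<alpha>"
  let ?I = "\<lambda>y. \<integral>\<^sup>+x. indicator ?D x * ennreal (1 / dist x y) \<partial>lborel"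
  obtain C where C: "C < \<infinity>" "\<And>y. ?I y \<le> emeasure lborel ?D + C"
    by (rule nn_integral_inverse_dist_bounded[where 'a = "real ^ 3"]) auto
  have fin: "emeasure lborel ?D + C < \<infinity>"
    using C(1) emeasure_box_D_finite by (simp add: less_top)
  then have I_fin: "?I y < \<infinity>" for y
    using C(2) le_less_trans by blast
  have "(\<integral>\<^sup>+y. indicator ?D y * ?I y \<partial>lborel) \<le> (\<integral>\<^sup>+y. indicator ?D y * (emeasure lborel ?D + C) \<partial>lborel)"
    by (intro nn_integral_mono mult_left_mono C) auto
  also have "\<dots> = emeasure lborel ?D * (emeasure lborel ?D + C)"
    by (simp add: nn_integral_multc)
  also have "\<dots> < \<infinity>"
    using fin emeasure_box_D_finite[of \<alpha>] by (simp add: ennreal_mult_less_top)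
  finally have int_fin: "(\<integral>\<^sup>+z. ennreal (overlap \<alpha> z / norm z) \<partial>lborel) < \<infinity>"
    by (simp add: nn_integral_box_D_kernel)
  then show "integrable lborel (\<lambda>z. overlap \<alpha> z / norm z)"
    by (intro integrableI_nonneg) (auto simp: overlap_nonneg)
  have inner: "(LINT x:?D|lborel. 1 / dist x y) = enn2real (?I y)" for y
    unfolding set_lebesgue_integral_def
    by (subst integral_eq_nn_integral)
      (auto intro!: arg_cong[where f = enn2real] nn_integral_cong split: split_indicator)
  have "Delta \<alpha> = (LINT y|lborel. indicator ?D y * enn2real (?I y))"
    unfolding Delta_def inner by (simp add: set_lebesgue_integral_def)
  also have "\<dots> = enn2real (\<integral>\<^sup>+y. ennreal (indicator ?D y * enn2real (?I y)) \<partial>lborel)"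
    by (intro integral_eq_nn_integral) auto
  also have "(\<lambda>y. ennreal (indicator ?D y * enn2real (?I y))) = (\<lambda>y. indicator ?D y * ?I y)"
    using I_fin by (auto simp: fun_eq_iff split: split_indicator)
  also have "enn2real (\<integral>\<^sup>+y. indicator ?D y * ?I y \<partial>lborel) = (LINT z|lborel. overlap \<alpha> z / norm z)"
    unfolding nn_integral_box_D_kernel
    by (intro integral_eq_nn_integral[symmetric]) (auto simp: overlap_nonneg)
  finally show "Delta \<alpha> = (LINT z|lborel. overlap \<alpha> z / norm z)" .
qed

section \<open>The reflection\<close>

text \<open>
  For \<open>M > 0\<close> the reflection of \<open>ln (z\<^sub>1 / z\<^sub>2) / 2\<close> about \<open>ln M / 2\<close> that keeps the product
  \<open>z\<^sub>1 z\<^sub>2\<close>. It maps the plane \<open>z\<^sub>1 = M z\<^sub>2\<close> to itself pointwise.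
\<close>

definition reflect :: "real \<Rightarrow> real ^ 3 \<Rightarrow> real ^ 3" where
  "reflect M z = vector [M * z$2, z$1 / M, z$3]"

lemma reflect_nth [simp]:
  "reflect M z $ 1 = M * z$2" "reflect M z $ 2 = z$1 / M" "reflect M z $ 3 = z$3"
  by (simp_all add: reflect_def)

lemma reflect_involution: "M \<noteq> 0 \<Longrightarrow> reflect M (reflect M z) = z"
  by (simp add: vec_eq_iff forall_3)

lemma measurable_reflect [measurable]: "reflect M \<in> borel_measurable borel"
proof -
  have "continuous_on UNIV (\<lambda>z. reflect M z $ i)" for i
    using exhaust_3[of i]
    by (elim disjE; simp add: divide_inverse continuous_on_mult_left continuous_on_mult_right continuous_on_component)
  then have "continuous_on UNIV (\<lambda>z. \<chi> i. reflect M z $ i)"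
    by (rule continuous_on_vec_lambda)
  then show ?thesis by (intro borel_measurable_continuous_onI) (simp add: vec_nth_inverse)
qed

text \<open>
  The map exchanges two sides of a box and scales them by \<open>M\<close> and \<open>1 / M\<close>, so it preserves the
  volume of boxes, which determines Lebesgue measure.
\<close>

lemma lborel_distr_reflect:
  assumes "0 < M"
  shows "distr lborel borel (reflect M) = lborel"
proof (rule lborel_eqI[symmetric])
  fix l u :: "real ^ 3"
  assume le: "\<And>b. b \<in> Basis \<Longrightarrow> l \<bullet> b \<le> u \<bullet> b"
  have le': "l $ i \<le> u $ i" for i
    using le[of "axis i 1"] by (simp add: inner_axis)
  \<comment> \<open>The preimage is the image, since the map is an involution.\<close>
  have "reflect M -` box l u = box (reflect M l) (reflect M u)"
    using assms by (auto simp: mem_box_cart forall_3 field_simps)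
  then have "emeasure (distr lborel borel (reflect M)) (box l u)
      = emeasure lborel (cbox (reflect M l) (reflect M u))"
    by (simp add: emeasure_distr emeasure_lborel_box_eq emeasure_lborel_cbox_eq)
  also have "\<dots> = emeasure lborel (cbox l u)"
  proof -
    have "max 0 (M * u$2 - M * l$2) * max 0 (u$1 / M - l$1 / M) = max 0 (u$1 - l$1) * max 0 (u$2 - l$2)"
      using assms le'[of 1] le'[of 2]
      by (simp add: max_absorb2 divide_right_mono flip: right_diff_distrib diff_divide_distrib)
    then show ?thesis by (simp add: emeasure_lborel_cbox_vec3)
  qed
  also have "\<dots> = ennreal (\<Prod>b\<in>Basis. (u - l) \<bullet> b)"
    using le by (simp add: emeasure_lborel_cbox_eq)
  finally show "emeasure (distr lborel borel (reflect M)) (box l u) = ennreal (\<Prod>b\<in>Basis. (u - l) \<bullet> b)" .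
qed simp

lemma
  fixes f :: "real ^ 3 \<Rightarrow> real"
  assumes "0 < M" and [measurable]: "f \<in> borel_measurable borel"
  shows integral_reflect: "(LINT z|lborel. f (reflect M z)) = (LINT z|lborel. f z)"
    and integrable_reflect: "integrable lborel f \<Longrightarrow> integrable lborel (\<lambda>z. f (reflect M z))"
  using integral_distr[of "reflect M" lborel borel f] integrable_distr[of "reflect M" lborel borel f]
  by (simp_all add: lborel_distr_reflect assms)

text \<open>
  The tents in the first two coordinates trade places: \<open>a - a b \<bar>z\<^sub>2\<bar>\<close> is \<open>a b\<close> times
  \<open>1 / b - \<bar>z\<^sub>2\<bar>\<close>, and the factor \<open>a b\<close> cancels against the one from the other coordinate.
\<close>

lemma overlap_reflect:
  assumes "0 < a" "0 < b"
  shows "overlap a (reflect (a * b) z) = overlap b z"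
proof -
  have "a * b * (inverse b - \<bar>z$2\<bar>) = a - \<bar>a * b * z$2\<bar>"
    using assms by (simp add: abs_mult field_simps)
  then have "max 0 (a - \<bar>a * b * z$2\<bar>) = a * b * max 0 (inverse b - \<bar>z$2\<bar>)"
    using assms by (simp add: max_mult_distrib_left)
  moreover have "(b - \<bar>z$1\<bar>) / (a * b) = inverse a - \<bar>z$1 / (a * b)\<bar>"
    using assms by (simp add: abs_mult field_simps)
  then have "max 0 (inverse a - \<bar>z$1 / (a * b)\<bar>) = max 0 (b - \<bar>z$1\<bar>) / (a * b)"
    using assms by (simp add: max_divide_distrib_right)
  ultimately show ?thesis
    using assms by (simp add: overlap_def)
qed

lemma norm_vec3: "norm (z :: real ^ 3) = sqrt ((z$1)\<^sup>2 + (z$2)\<^sup>2 + (z$3)\<^sup>2)"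
  by (simp add: norm_vec_def L2_set_def sum_3)

lemma Delta_inverse:
  assumes "0 < \<alpha>"
  shows "Delta (inverse \<alpha>) = Delta \<alpha>"
proof -
  have "norm (reflect 1 z) = norm z" for z
    by (simp add: norm_vec3 add.commute)
  moreover have "overlap \<alpha> (reflect 1 z) = overlap (inverse \<alpha>) z" for z
    using overlap_reflect[of \<alpha> "inverse \<alpha>" z] assms by simp
  ultimately show ?thesis
    using integral_reflect[of 1 "\<lambda>z. overlap \<alpha> z / norm z"]
    by (simp add: Delta_eq_overlap_integral)
qed

section \<open>Strict monotonicity\<close>

text \<open>
  On this side of the mirror the points inside the \<open>b\<close>-tents lie inside the \<open>a\<close>-tents as well, so
  at such a point all truncations in the first two coordinates can be dropped. The products of the tents then
  differ only in their linear terms, because both have constant term \<open>1\<close> and quadratic term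
  \<open>\<bar>z\<^sub>1\<bar> \<bar>z\<^sub>2\<bar>\<close>.
\<close>

lemma overlap_diff:
  assumes "0 < a" "a < b" "\<bar>z$1\<bar> < b" "\<bar>z$2\<bar> < inverse b" "\<bar>z$1\<bar> \<le> a * b * \<bar>z$2\<bar>"
  shows "overlap a z - overlap b z =
    (b - a) * (\<bar>z$2\<bar> - \<bar>z$1\<bar> / (a * b)) * max 0 (1 - \<bar>z$3\<bar>)"
proof -
  have q: "\<bar>z$2\<bar> < 1 / b"
    using assms by (simp add: divide_inverse)
  have "b * \<bar>z$2\<bar> < 1" using q assms by (simp add: field_simps)
  then have "a * (b * \<bar>z$2\<bar>) < a * 1"
    using assms by (intro mult_strict_left_mono) auto
  moreover have "\<bar>z$1\<bar> \<le> a * (b * \<bar>z$2\<bar>)"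
    using assms by (simp add: mult.assoc)
  ultimately have p: "\<bar>z$1\<bar> < a" by linarith
  have "inverse b < inverse a" using assms by simp
  then have q': "\<bar>z$2\<bar> < inverse a" using assms by linarith
  have "(a - \<bar>z$1\<bar>) * (inverse a - \<bar>z$2\<bar>) - (b - \<bar>z$1\<bar>) * (inverse b - \<bar>z$2\<bar>)
      = (b - a) * (\<bar>z$2\<bar> - \<bar>z$1\<bar> / (a * b))"
    using assms by (simp add: field_simps)
  then show ?thesis
    using p q' assms by (simp add: overlap_def flip: left_diff_distrib)
qed

lemma overlap_le:
  assumes "0 < a" "a < b" "\<bar>z$1\<bar> \<le> a * b * \<bar>z$2\<bar>"
  shows "overlap b z \<le> overlap a z"
proof (cases "\<bar>z$1\<bar> < b \<and> \<bar>z$2\<bar> < inverse b")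
  case True
  have "0 \<le> \<bar>z$2\<bar> - \<bar>z$1\<bar> / (a * b)"
    using assms by (simp add: field_simps)
  then have "0 \<le> overlap a z - overlap b z"
    using True assms by (simp add: overlap_diff)
  then show ?thesis by simp
next
  case False
  then have "overlap b z = 0" by (auto simp: overlap_def)
  then show ?thesis by (simp add: overlap_nonneg)
qed

text \<open>
  The squared norm changes by \<open>(1 - 1 / M\<^sup>2) (M\<^sup>2 z\<^sub>2\<^sup>2 - z\<^sub>1\<^sup>2)\<close>.
\<close>

lemma norm_reflect_le:
  assumes "1 < M"
  shows "norm z \<le> norm (reflect M z) \<longleftrightarrow> \<bar>z$1\<bar> \<le> M * \<bar>z$2\<bar>"
proof -
  have "1 < M\<^sup>2" using assms by (simp add: one_less_power)
  then have c: "0 < 1 - 1 / M\<^sup>2" by (subst diff_gt_0_iff_gt, subst divide_less_eq_1_pos) auto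
  have eq: "(M * z$2)\<^sup>2 + (z$1 / M)\<^sup>2 - (z$1)\<^sup>2 - (z$2)\<^sup>2
      = (1 - 1 / M\<^sup>2) * ((M * z$2)\<^sup>2 - (z$1)\<^sup>2)"
    using assms by (simp add: field_simps)
  have "(z$1)\<^sup>2 + (z$2)\<^sup>2 \<le> (M * z$2)\<^sup>2 + (z$1 / M)\<^sup>2 \<longleftrightarrow>
      0 \<le> (1 - 1 / M\<^sup>2) * ((M * z$2)\<^sup>2 - (z$1)\<^sup>2)"
    unfolding eq[symmetric] by linarith
  also have "\<dots> \<longleftrightarrow> (z$1)\<^sup>2 \<le> (M * z$2)\<^sup>2"
    unfolding zero_le_mult_iff using c by linarith
  also have "\<dots> \<longleftrightarrow> \<bar>z$1\<bar> \<le> M * \<bar>z$2\<bar>"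
    using assms by (simp add: abs_le_square_iff[symmetric] abs_mult)
  finally show ?thesis by (simp add: norm_vec3)
qed

text \<open>
  The hypothesis \<open>1 < a * b\<close> says that the mirror lies strictly beyond the centre of the kernel
  \<open>1 / \<bar>z\<bar>\<close>, on the side of the parameter \<open>b\<close>. It holds in particular when \<open>1 \<le> a\<close>, which includes the
  comparison with the cube, \<open>a = 1\<close>.
\<close>

lemma Delta_strict_antimono:
  assumes "0 < a" "a < b" "1 < a * b"
  shows "Delta b < Delta a"
proof -
  define M where "M = a * b"
  have M: "1 < M" using assms by (simp add: M_def)
  have b: "0 < b" using assms by simp
  let ?T = "reflect M"
  let ?G = "\<lambda>z::real^3. (overlap a z - overlap b z) / norm z"
  let ?F = "\<lambda>z. (overlap a z - overlap b z) * (1 / norm z - 1 / norm (?T z))"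
  have swap: "overlap a (?T z) = overlap b z" "overlap b (?T z) = overlap a z" for z
    using overlap_reflect[of a b z] overlap_reflect[of b a z] assms b
    by (simp_all add: M_def mult.commute)
  have G: "integrable lborel ?G"
    using integrable_overlap_kernel[of a] integrable_overlap_kernel[of b]
    by (simp add: diff_divide_distrib)
  have GT: "integrable lborel (\<lambda>z. ?G (?T z))"
    using G M by (intro integrable_reflect) auto
  have F_eq: "?F z = ?G z + ?G (?T z)" for z
    by (simp add: swap algebra_simps diff_divide_distrib)
  have F: "integrable lborel ?F"
    unfolding F_eq using G GT by (rule Bochner_Integration.integrable_add)
  have G_int: "(LINT z|lborel. ?G z) = Delta a - Delta b"
    using integrable_overlap_kernel[of a] integrable_overlap_kernel[of b]
    by (simp add: diff_divide_distrib Delta_eq_overlap_integral)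
  have F_int: "(LINT z|lborel. ?F z) = 2 * (Delta a - Delta b)"
  proof -
    have "(LINT z|lborel. ?F z) = (LINT z|lborel. ?G z) + (LINT z|lborel. ?G (?T z))"
      unfolding F_eq using G GT by (rule Bochner_Integration.integral_add)
    also have "(LINT z|lborel. ?G (?T z)) = (LINT z|lborel. ?G z)"
      using M by (intro integral_reflect) auto
    finally show ?thesis using G_int by simp
  qed
  \<comment> \<open>At the origin both kernel values are \<open>1 / 0 = 0\<close>, so the inequality extends to it.\<close>
  have F_near: "0 \<le> ?F z" if "\<bar>z$1\<bar> \<le> M * \<bar>z$2\<bar>" for z
  proof -
    have "1 / norm (?T z) \<le> 1 / norm z"
    proof (cases "z = 0")
      case True
      then have "?T z = 0" by (simp add: vec_eq_iff forall_3)
      then show ?thesis by simp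
    next
      case False
      then show ?thesis
        using that M norm_reflect_le[of M z] zero_less_norm_iff[of z]
        by (intro divide_left_mono mult_pos_pos) auto
    qed
    moreover have "overlap b z \<le> overlap a z"
      using that assms by (intro overlap_le) (auto simp: M_def)
    ultimately show ?thesis by simp
  qed
  \<comment> \<open>Both factors change sign under the reflection, so the far side reduces to the near side.\<close>
  have F_nonneg: "0 \<le> ?F z" for z
  proof (cases "\<bar>z$1\<bar> \<le> M * \<bar>z$2\<bar>")
    case True
    then show ?thesis by (rule F_near)
  next
    case False
    then have "\<bar>?T z $ 1\<bar> \<le> M * \<bar>?T z $ 2\<bar>"
      using M by (simp add: abs_mult)
    then have "0 \<le> ?F (?T z)" by (rule F_near)
    also have "?F (?T z) = ?F z"
      using M by (simp add: swap reflect_involution algebra_simps)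
    finally show ?thesis .
  qed
  \<comment> \<open>A box inside the support of the \<open>a\<close>-overlap and strictly on the near side of the mirror,
    since there \<open>z\<^sub>1 < a / 2 < M z\<^sub>2\<close>.\<close>
  let ?l = "vector [0, inverse b / 2, 0] :: real ^ 3"
  let ?u = "vector [a / 2, inverse b, 1] :: real ^ 3"
  have F_pos: "0 < ?F z" if "z \<in> box ?l ?u" for z
  proof -
    have z: "0 < z$1" "z$1 < a / 2" "inverse b / 2 < z$2" "z$2 < inverse b" "0 < z$3" "z$3 < 1"
      using that by (auto simp: mem_box_cart forall_3)
    have "0 < z$2" using z b by (meson less_trans half_gt_zero positive_imp_inverse_positive)
    have "a * b * (inverse b / 2) < a * b * z$2"
      using z assms b by (intro mult_strict_left_mono) auto
    moreover have "a * b * (inverse b / 2) = a / 2" using b by simp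
    ultimately have z12: "z$1 < M * z$2"
      unfolding M_def using z by linarith
    have "overlap a z - overlap b z = (b - a) * (z$2 - z$1 / M) * (1 - z$3)"
      using z z12 assms \<open>0 < z$2\<close> by (subst overlap_diff) (simp_all add: M_def)
    moreover have "0 < z$2 - z$1 / M"
      using z12 M by (simp add: field_simps)
    ultimately have "0 < overlap a z - overlap b z"
      using z assms by simp
    moreover have "1 / norm (?T z) < 1 / norm z"
    proof -
      \<comment> \<open>Strictness comes from the equivalence at the mirror image, which lies on the far side.\<close>
      have "\<not> norm (?T z) \<le> norm (?T (?T z))"
        using norm_reflect_le[OF M, of "?T z"] z z12 \<open>0 < z$2\<close> M by (simp add: abs_mult)
      then have "norm z < norm (?T z)"
        using M by (simp add: reflect_involution)
      moreover have "z \<noteq> 0" using z by auto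
      ultimately show ?thesis
        using zero_less_norm_iff[of z] by (intro divide_strict_left_mono mult_pos_pos) auto
    qed
    ultimately show ?thesis by simp
  qed
  have "(LINT z|lborel. ?F z) \<noteq> 0"
  proof
    assume "(LINT z|lborel. ?F z) = 0"
    then have "AE z in lborel. ?F z = 0"
      using integral_nonneg_eq_0_iff_AE[OF F] F_nonneg by blast
    then have "AE z in lborel. z \<notin> box ?l ?u"
      by (rule eventually_mono) (metis F_pos less_irrefl)
    then have "emeasure lborel (box ?l ?u) = 0"
      by (intro null_setsD1) (simp add: AE_iff_null_sets)
    moreover have "emeasure lborel (box ?l ?u) = emeasure lborel (cbox ?l ?u)"
      by (simp only: emeasure_lborel_box_eq emeasure_lborel_cbox_eq)
    moreover have "emeasure lborel (cbox ?l ?u) = ennreal (a / 2 * (inverse b / 2) * 1)"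
      using assms b by (simp add: emeasure_lborel_cbox_vec3)
    ultimately show False
      using assms b by simp
  qed
  moreover have "0 \<le> (LINT z|lborel. ?F z)"
    using F_nonneg by (intro integral_nonneg_AE) auto
  ultimately show ?thesis using F_int by simp
qed

theorem proposition8p7:
  shows "(\<forall>\<alpha>>0. Delta \<alpha> = Delta (inverse \<alpha>)) \<and>
    strict_antimono_on {0<..} (\<lambda>\<beta>::real. Delta (exp \<beta>)) \<and>
    (\<forall>\<alpha>>0. Delta \<alpha> \<le> Delta 1 \<and> (Delta \<alpha> = Delta 1 \<longleftrightarrow> \<alpha> = 1))"
proof (intro conjI allI impI)
  fix \<alpha> :: real
  assume \<alpha>: "0 < \<alpha>"
  then show "Delta \<alpha> = Delta (inverse \<alpha>)" by (simp add: Delta_inverse)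
  have gt: "Delta c < Delta 1" if "1 < c" for c
    using that by (intro Delta_strict_antimono) auto
  have "Delta \<alpha> < Delta 1" if "\<alpha> \<noteq> 1"
  proof (cases "1 < \<alpha>")
    case True
    then show ?thesis by (rule gt)
  next
    case False
    then have "1 < inverse \<alpha>" using \<alpha> that by (simp add: one_less_inverse)
    then have "Delta (inverse \<alpha>) < Delta 1" by (rule gt)
    then show ?thesis using \<alpha> by (simp add: Delta_inverse)
  qed
  then show "Delta \<alpha> \<le> Delta 1" "Delta \<alpha> = Delta 1 \<longleftrightarrow> \<alpha> = 1"
    by (cases "\<alpha> = 1"; force)+
next
  show "strict_antimono_on {0<..} (\<lambda>\<beta>::real. Delta (exp \<beta>))"
  proof (rule monotone_onI)
    fix \<beta> \<gamma> :: real
    assume "\<beta> \<in> {0<..}" "\<gamma> \<in> {0<..}" "\<beta> < \<gamma>"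
    then show "Delta (exp \<gamma>) < Delta (exp \<beta>)"
      by (intro Delta_strict_antimono) (auto simp flip: exp_add)
  qed
qed

end
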